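(* Let $n\ge 3$. Let $A=(1,a_2,a_3,\dots,a_n)\in X$ and $B=(-1,b_2,b_3,\dots,b_n)\in X$. Then the geodesic distance between $A$ and $B$ is equal to the minimum of the following numbers: for every integer $m$ with $1\le m\le n-1$, every sequence $(p_1,\dots,p_m)$ of distinct elements of $\{2,3,\dots,n\}$, and every choice of signs $\varepsilon_1,\dots,\varepsilon_m\in\{1,-1\}$, the maximum of the numbers \[4+\varepsilon_1 a_{p_1}+\varepsilon_m b_{p_m}\] and \[2+\varepsilon_{t+1}a_{p_{t+1}}+\varepsilon_t b_{p_t}\quad\text{for } 1\le t\le m-1.\] (For $m=1$ this is the single number $4+\varepsilon_1 a_{p_1}+\varepsilon_1 b_{p_1}$.)
   Context: Let $X=\{x\in\mathbb{R}^n:\|x\|_\infty=1\}$ be the unit sphere of $\mathbb{R}^n$ with the sup norm $\|x\|_\infty=\max_i|x_i|$. The geodesic distance between $A,B\in X$ is the one induced by the sup norm: the shortest arc length (measured with $\|\cdot\|_\infty$) among all curves lying on $X$ that join $A$ and $B$. Convention: only paths whose nonvoid intersection with each $(n-1)$-dimensional face ($\{x\in X:x_i=1\}$ or $\{x\in X:x_i=-1\}$) is a line segment are considered, so every path from $A$ to $B$ is a finite sequence of line segments $AC_1,C_1C_2,\dots,C_rB$, where each $C_i$ lies in an $(n-2)$-dimensional face of $X$. *)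

theory Defs
  imports "HOL-Analysis.Analysis"
begin

text \<open>The norm of type \<^typ>\<open>real ^ 'n\<close> is Euclidean; the sup norm is \<^const>\<open>infnorm\<close>.\<close>

definition sup_sphere :: "(real ^ 'n) set" where
  "sup_sphere = {x. infnorm x = 1}"

definition facet :: "'n \<Rightarrow> real \<Rightarrow> (real ^ 'n) set" where
  "facet i s = {x \<in> sup_sphere. x $ i = s}"

text \<open>Arc length with respect to the sup norm: the supremum of the lengths of inscribed polygons,
  over all finite subdivisions of the parameter interval; it is \<open>\<infinity>\<close> for a
  non-rectifiable curve.\<close>

definition arc_length :: "(real \<Rightarrow> real ^ 'n) \<Rightarrow> ereal" where
  "arc_length g = (SUP ts \<in> {ts. sorted ts \<and> set ts \<subseteq> {0..1}}.
     ereal (\<Sum>k < length ts - 1. infnorm (g (ts ! Suc k) - g (ts ! k))))"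

text \<open>A single point counts as a (degenerate) line segment, as it must for a path that
  merely touches a facet.\<close>

definition admissible_paths :: "real ^ 'n \<Rightarrow> real ^ 'n \<Rightarrow> (real \<Rightarrow> real ^ 'n) set" where
  "admissible_paths A B =
     {g. path g \<and> path_image g \<subseteq> sup_sphere \<and> pathstart g = A \<and> pathfinish g = B \<and>
         (\<forall>i. \<forall>s \<in> {1, -1}. path_image g \<inter> facet i s \<noteq> {} \<longrightarrow>
            (\<exists>P Q. path_image g \<inter> facet i s = closed_segment P Q))}"

text \<open>A predicate rather than a function defined as an infimum, since the geodesic distance is
  the length of a shortest path: the value has to be attained. It is unique if it exists.\<close>

definition is_geodesic_distance :: "real ^ 'n \<Rightarrow> real ^ 'n \<Rightarrow> real \<Rightarrow> bool" where
  "is_geodesic_distance A B d \<longleftrightarrow>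
     (\<exists>g \<in> admissible_paths A B. arc_length g = ereal d) \<and>
     (\<forall>g \<in> admissible_paths A B. ereal d \<le> arc_length g)"

end

theory Submission
  imports Defs
begin

text \<open>The length of a path bounds the change of every single coordinate, and both estimates come
  from looking at one coordinate at a time. Let \<open>i\<close> be the coordinate which is 1 at \<open>A\<close> and -1 at
  \<open>B\<close>, and call the facets belonging to the other coordinates side facets. The gap between a
  point and the side facet \<open>x\<^sub>p = - \<epsilon>\<close> is \<open>1 + \<epsilon> x\<^sub>p\<close>. A chain of side facets has value at most \<open>d\<close>
  if 2 plus the gap between \<open>A\<close> and the first facet plus the gap between \<open>B\<close> and the last facet is
  at most \<open>d\<close>, and if for consecutive facets \<open>F\<close>, \<open>G\<close> the gap between \<open>A\<close> and \<open>G\<close> plus the gap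
  between \<open>B\<close> and \<open>F\<close> is at most \<open>d\<close>.

  Lower bound (\<open>chain_within_arc_length\<close>). While a path crosses from \<open>x\<^sub>i = 1\<close> to \<open>x\<^sub>i = -1\<close>, which
  takes length 2, it stays on side facets, and by connectedness these contain a walk from the
  facet in which the crossing starts to the one in which it ends, consecutive facets being met at
  a common time. Each of the inequalities above compares the path with the times at which such
  facets are met. A walk with the fewest facets has distinct coordinates.

  Upper bound (\<open>ex_admissible_path\<close>). Take a chain with the fewest facets among those of least
  value \<open>D\<close>. That no facet can be omitted forces the gaps from \<open>A\<close> to increase strictly along the
  chain and those to \<open>B\<close> to decrease strictly. So the facets can be reached at the times given by the
  gaps from \<open>A\<close>, every coordinate moving at speed at most 1 during a total time \<open>D\<close>; and the
  strictness, together with the optimality of \<open>D\<close>, makes the path meet every facet in a single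
  segment (\<open>facet_times\<close>).\<close>


section \<open>Sup norm, arc length and facets\<close>

lemma infnorm_le_iff_cart: "infnorm (x :: real ^ 'n) \<le> c \<longleftrightarrow> (\<forall>i. \<bar>x $ i\<bar> \<le> c)"
  unfolding infnorm_cart by (subst cSup_le_iff) (auto simp: full_SetCompr_eq)

lemma mem_sup_sphere_iff:
  "x \<in> sup_sphere \<longleftrightarrow> (\<forall>j. \<bar>x $ j\<bar> \<le> 1) \<and> (\<exists>j. \<bar>x $ j\<bar> = 1)"
proof -
  have "infnorm x \<in> range (\<lambda>j. \<bar>x $ j\<bar>)"
  proof -
    have "infnorm x = Max (range (\<lambda>j. \<bar>x $ j\<bar>))"
      unfolding infnorm_cart by (subst cSup_eq_Max) (auto simp: full_SetCompr_eq)
    then show ?thesis by (metis Max_in UNIV_not_empty finite_code finite_imageI image_is_empty)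
  qed
  then obtain k where "infnorm x = \<bar>x $ k\<bar>" by auto
  then show ?thesis
    unfolding sup_sphere_def using infnorm_le_iff_cart[of x 1] component_le_infnorm_cart[of x]
    by (auto simp: order_antisym) (metis order_antisym)+
qed

lemma arc_length_ge_three_steps:
  fixes g :: "real \<Rightarrow> real ^ 'n"
  assumes "0 \<le> u" "u \<le> v" "v \<le> 1"
  shows "ereal (infnorm (g u - g 0) + infnorm (g v - g u) + infnorm (g 1 - g v)) \<le> arc_length g"
proof -
  have "ereal (\<Sum>k < length [0, u, v, 1] - 1.
      infnorm (g ([0, u, v, 1] ! Suc k) - g ([0, u, v, 1] ! k))) \<le> arc_length g"
    unfolding arc_length_def
    by (rule SUP_upper) (use assms in auto)
  then show ?thesis
    by (simp add: numeral_3_eq_3 add.assoc)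
qed

lemma arc_length_nonneg: "0 \<le> arc_length g"
proof -
  have "ereal (\<Sum>k < length ([]::real list) - 1. infnorm (g ([] ! Suc k) - g ([] ! k))) \<le> arc_length g"
    unfolding arc_length_def by (rule SUP_upper) auto
  then show ?thesis by (simp add: zero_ereal_def)
qed

lemma arc_length_le_of_lipschitz:
  fixes g :: "real \<Rightarrow> real ^ 'n"
  assumes lip: "\<And>u v. 0 \<le> u \<Longrightarrow> u \<le> v \<Longrightarrow> v \<le> 1 \<Longrightarrow> infnorm (g v - g u) \<le> D * (v - u)"
    and "0 \<le> D"
  shows "arc_length g \<le> ereal D"
  unfolding arc_length_def
proof (rule SUP_least, clarsimp)
  fix ts :: "real list"
  assume ts: "sorted ts" "set ts \<subseteq> {0..1}"
  show "(\<Sum>k < length ts - Suc 0. infnorm (g (ts ! Suc k) - g (ts ! k))) \<le> D"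
  proof (cases "ts = []")
    case False
    have mem: "ts ! k \<in> {0..1}" if "k < length ts" for k
      using that ts(2) nth_mem by blast
    have "(\<Sum>k < length ts - Suc 0. infnorm (g (ts ! Suc k) - g (ts ! k)))
        \<le> (\<Sum>k < length ts - Suc 0. D * (ts ! Suc k) - D * (ts ! k))"
    proof (rule sum_mono)
      fix k assume "k \<in> {..<length ts - Suc 0}"
      then have k: "Suc k < length ts" by auto
      then have "ts ! k \<le> ts ! Suc k" using ts(1) by (simp add: sorted_nth_mono)
      then show "infnorm (g (ts ! Suc k) - g (ts ! k)) \<le> D * (ts ! Suc k) - D * (ts ! k)"
        using lip[of "ts ! k" "ts ! Suc k"] mem[of k] mem[of "Suc k"] k
        by (simp add: algebra_simps)
    qed
    also have "\<dots> = D * (ts ! (length ts - Suc 0)) - D * (ts ! 0)"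
      by (rule sum_lessThan_telescope)
    also have "\<dots> = D * (ts ! (length ts - Suc 0) - ts ! 0)"
      by (simp add: algebra_simps)
    also have "\<dots> \<le> D * 1"
      using mem[of 0] mem[of "length ts - Suc 0"] False \<open>0 \<le> D\<close>
      by (intro mult_left_mono) auto
    finally show ?thesis by simp
  qed (use \<open>0 \<le> D\<close> in simp)
qed

text \<open>A pair \<open>(j, e)\<close> with \<open>e = \<plusminus>1\<close> encodes the facet \<open>x\<^sub>j = - e\<close>; then \<open>gap x (j, e)\<close> is
  the sup-norm distance from a point \<open>x\<close> of the cube to that facet, and it vanishes exactly
  on it. The sign convention is that of the expressions \<open>4 + \<epsilon>\<^sub>1 a\<^sub>p + \<epsilon>\<^sub>m b\<^sub>q\<close> in the theorem.\<close>

definition gap :: "real ^ 'n \<Rightarrow> 'n \<times> real \<Rightarrow> real" where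
  "gap x y = 1 + snd y * x $ fst y"

text \<open>The facets that prescribe a coordinate other than \<open>i\<close>.\<close>

definition side_facets :: "'n \<Rightarrow> ('n \<times> real) set" where
  "side_facets i = (UNIV - {i}) \<times> {1, -1}"

lemma finite_side_facets: "finite (side_facets (i :: 'n :: finite))"
  by (simp add: side_facets_def)

lemma side_facets_opposite:
  assumes "y \<in> side_facets i" "z \<in> side_facets i" "fst y = fst z" "y \<noteq> z"
  shows "gap x z = 2 - gap x y"
  using assms by (auto simp: side_facets_def gap_def)

lemma gap_diff_le_infnorm:
  assumes "y \<in> side_facets i"
  shows "\<bar>gap x y - gap x' y\<bar> \<le> infnorm (x - x')"
  using assms component_le_infnorm_cart[of "x - x'" "fst y"]
  by (auto simp: side_facets_def gap_def)

lemma gap_bounds: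
  assumes "y \<in> side_facets i" "x \<in> sup_sphere"
  shows "0 \<le> gap x y" "gap x y \<le> 2"
proof -
  have "\<bar>x $ fst y\<bar> \<le> 1" using assms(2) by (simp add: mem_sup_sphere_iff)
  then show "0 \<le> gap x y" "gap x y \<le> 2"
    using assms(1) by (auto simp: side_facets_def gap_def)
qed

text \<open>A chain is a list of side facets, of pairwise distinct coordinates, to be crossed one after
  the other on the way from \<open>x\<^sub>i = 1\<close> to \<open>x\<^sub>i = -1\<close>.\<close>

definition facet_chain :: "'n \<Rightarrow> ('n \<times> real) list \<Rightarrow> bool" where
  "facet_chain i xs \<longleftrightarrow> xs \<noteq> [] \<and> set xs \<subseteq> side_facets i \<and> distinct (map fst xs)"

text \<open>The maximum of the numbers attached to the chain \<open>xs\<close> is at most \<open>d\<close>: as a gap is \<open>1 + \<epsilon> x\<^sub>p\<close>,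
  the first conjunct is about \<open>4 + \<epsilon>\<^sub>1 a\<^sub>p + \<epsilon>\<^sub>m b\<^sub>q\<close> and the second one about the numbers
  that start with 2.\<close>

definition chain_within :: "real ^ 'n \<Rightarrow> real ^ 'n \<Rightarrow> ('n \<times> real) list \<Rightarrow> real \<Rightarrow> bool" where
  "chain_within A B xs d \<longleftrightarrow>
     2 + gap A (hd xs) + gap B (last xs) \<le> d \<and>
     successively (\<lambda>y z. gap A z + gap B y \<le> d) xs"


section \<open>Every path on the sphere is at least as long as the value of some chain\<close>

lemma ex_side_facet:
  assumes "x \<in> sup_sphere" "x $ i \<noteq> 1" "x $ i \<noteq> - 1"
  shows "\<exists>y \<in> side_facets i. gap x y = 0"
proof -
  obtain j where j: "\<bar>x $ j\<bar> = 1" using assms(1) by (auto simp: mem_sup_sphere_iff)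
  then have "(j, - x $ j) \<in> side_facets i" "gap x (j, - x $ j) = 0"
    using assms(2,3) by (auto simp: side_facets_def gap_def abs_if split: if_splits)
  then show ?thesis by blast
qed

text \<open>Between the first visit to \<open>x\<^sub>i = -1\<close> and the last visit to \<open>x\<^sub>i = 1\<close> before it, the path is
  covered by the side facets; as an interval is connected, the facets at its two ends are joined by a walk
  in which consecutive facets are met simultaneously by the path.\<close>

lemma ex_facet_walk:
  fixes g :: "real \<Rightarrow> real ^ 'n"
  assumes "path g" "path_image g \<subseteq> sup_sphere" "pathstart g $ i = 1" "pathfinish g $ i = - 1"
  obtains s t xs where "0 \<le> s" "s \<le> t" "t \<le> 1" "g s $ i = 1" "g t $ i = - 1"
    "xs \<noteq> []" "set xs \<subseteq> side_facets i" "gap (g s) (hd xs) = 0" "gap (g t) (last xs) = 0"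
    "successively (\<lambda>y z. \<exists>u\<in>{0..1}. gap (g u) y = 0 \<and> gap (g u) z = 0) xs"
proof -
  have cont: "continuous_on {0..1} g" using assms(1) by (simp add: path_def)
  have conti: "continuous_on {0..1} (\<lambda>u. g u $ j)" for j
    using cont by (intro continuous_intros)
  have clo: "closed {u \<in> {a..b}. f (g u) = c}"
    if "0 \<le> a" "b \<le> 1" "continuous_on {0..1} (\<lambda>u. f (g u))" for a b c and f :: "real ^ 'n \<Rightarrow> real"
  proof -
    have "continuous_on {a..b} (\<lambda>u. f (g u))"
      using that(3) by (rule continuous_on_subset) (use that in auto)
    then show ?thesis
      by (intro continuous_closed_preimage_constant) auto
  qed
  have sph: "g u \<in> sup_sphere" if "u \<in> {0..1}" for u
    using assms(2) that by (auto simp: path_image_def)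
  have "closed {u \<in> {0..1}. g u $ i = - 1}" using clo[of 0 1 "\<lambda>x. x $ i" "-1"] conti by simp
  then have "compact {u \<in> {0..1}. g u $ i = - 1}"
    unfolding compact_eq_bounded_closed by (auto intro: bounded_subset[of "{0..1}"])
  moreover have "1 \<in> {u \<in> {0..1}. g u $ i = - 1}" using assms(4) by (simp add: pathfinish_def)
  ultimately obtain t where t: "t \<in> {0..1}" "g t $ i = - 1"
    and tmin: "\<And>u. u \<in> {0..1} \<Longrightarrow> g u $ i = - 1 \<Longrightarrow> t \<le> u"
    using compact_attains_inf[of "{u \<in> {0..1}. g u $ i = - 1}"] by blast
  have "closed {u \<in> {0..t}. g u $ i = 1}" using clo[of 0 t "\<lambda>x. x $ i" "1"] conti t by simp
  then have "compact {u \<in> {0..t}. g u $ i = 1}"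
    unfolding compact_eq_bounded_closed by (auto intro: bounded_subset[of "{0..t}"])
  moreover have "0 \<in> {u \<in> {0..t}. g u $ i = 1}" using assms(3) t by (simp add: pathstart_def)
  ultimately obtain s where s: "s \<in> {0..t}" "g s $ i = 1"
    and smax: "\<And>u. u \<in> {0..t} \<Longrightarrow> g u $ i = 1 \<Longrightarrow> u \<le> s"
    using compact_attains_sup[of "{u \<in> {0..t}. g u $ i = 1}"] by blast
  have st: "s < t" using s t by (cases "s = t") auto
  define K where "K y = {u \<in> {s..t}. gap (g u) y = 0}" for y
  have Kclosed: "closed (K y)" for y
    unfolding K_def
    by (rule clo) (use s t in \<open>auto simp: gap_def intro!: continuous_intros conti\<close>)
  let ?F = "side_facets i"
  have cover: "{s..t} \<subseteq> (\<Union>y\<in>?F. K y)"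
  proof -
    have "{s<..<t} \<subseteq> (\<Union>y\<in>?F. K y)"
    proof
      fix u assume u: "u \<in> {s<..<t}"
      then have "g u $ i \<noteq> 1" "g u $ i \<noteq> - 1"
        using smax[of u] tmin[of u] s t by force+
      moreover have "g u \<in> sup_sphere" using sph u s t by auto
      ultimately obtain y where "y \<in> ?F" "gap (g u) y = 0" using ex_side_facet by blast
      then show "u \<in> (\<Union>y\<in>?F. K y)" using u by (auto simp: K_def)
    qed
    \<comment> \<open>At the times \<open>s\<close> and \<open>t\<close> themselves a side facet is found by passing to the limit.\<close>
    moreover have "closed (\<Union>y\<in>?F. K y)"
      using Kclosed finite_side_facets by (intro closed_UN) auto
    ultimately have "closure {s<..<t} \<subseteq> (\<Union>y\<in>?F. K y)" by (rule closure_minimal)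
    then show ?thesis using st by simp
  qed
  let ?adj = "\<lambda>y z. \<exists>u\<in>{0..1}. gap (g u) y = 0 \<and> gap (g u) z = 0"
  obtain y0 where y0: "y0 \<in> ?F" "s \<in> K y0" using cover st by force
  define R where "R = {y. \<exists>xs. xs \<noteq> [] \<and> set xs \<subseteq> ?F \<and> hd xs = y0 \<and> last xs = y \<and>
    successively ?adj xs}"
  have y0R: "y0 \<in> R" unfolding R_def using y0 by (auto intro!: exI[of _ "[y0]"])
  have RF: "R \<subseteq> ?F" unfolding R_def by (auto dest: last_in_set)
  have Rstep: "z \<in> R" if y: "y \<in> R" and z: "z \<in> ?F" and yz: "?adj y z" for y z
  proof -
    obtain xs where "xs \<noteq> []" "set xs \<subseteq> ?F" "hd xs = y0" "last xs = y" "successively ?adj xs"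
      using y unfolding R_def by blast
    moreover from this have "successively ?adj (xs @ [z])"
      unfolding successively_append_iff using yz by simp
    ultimately show ?thesis
      unfolding R_def using z by (auto intro!: exI[of _ "xs @ [z]"])
  qed
  let ?U = "\<Union>y\<in>R. K y" and ?V = "\<Union>y\<in>?F - R. K y"
  have cl: "closed ?U" "closed ?V"
    using Kclosed finite_subset[OF RF finite_side_facets] finite_side_facets[of i]
    by (auto intro!: closed_UN)
  have cov: "{s..t} \<subseteq> ?U \<union> ?V" using cover by blast
  have disj: "?U \<inter> ?V \<inter> {s..t} = {}"
  proof (rule ccontr)
    assume "?U \<inter> ?V \<inter> {s..t} \<noteq> {}"
    then obtain u y z where "y \<in> R" "z \<in> ?F" "z \<notin> R" "u \<in> K y" "u \<in> K z" by blast
    moreover from this have "u \<in> {0..1}" "gap (g u) y = 0" "gap (g u) z = 0"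
      using s t by (auto simp: K_def)
    ultimately show False using Rstep[of y z] by blast
  qed
  have "?U \<inter> {s..t} \<noteq> {}" using y0R y0 st by force
  then have "?V \<inter> {s..t} = {}"
    using connected_Icc[of s t] cl cov disj unfolding connected_closed by blast
  moreover have "t \<in> {s..t}" using st by simp
  ultimately obtain y where "y \<in> R" "t \<in> K y" using cov by blast
  then obtain xs where "xs \<noteq> []" "set xs \<subseteq> ?F" "hd xs = y0" "last xs = y" "successively ?adj xs"
    unfolding R_def by blast
  then show ?thesis
    using that[of s t xs] s t y0 \<open>t \<in> K y\<close> by (auto simp: K_def)
qed


text \<open>Each joint visit to two facets gives the corresponding inequality of \<^const>\<open>chain_within\<close>, in
  both orders of the two facets, so only the distinctness of the coordinates is at issue. A walk
  with the fewest facets among those that satisfy the first inequality of \<^const>\<open>chain_within\<close> with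
  \<open>d\<close> the length of the path has this property. If it
  visits a facet twice, the loop can be cut out. If it visits \<open>x\<^sub>j = 1\<close> and \<open>x\<^sub>j = -1\<close>, then crossing from
  one to the other already takes length 2; so the part strictly between them, or its reverse when
  the path runs through it backwards, satisfies the first inequality as well.\<close>

lemma chain_within_arc_length:
  fixes g :: "real \<Rightarrow> real ^ 'n"
  assumes "path g" "path_image g \<subseteq> sup_sphere" "pathstart g = A" "pathfinish g = B"
    and "A $ i = 1" "B $ i = - 1" and l: "arc_length g = ereal l"
  shows "\<exists>xs. facet_chain i xs \<and> chain_within A B xs l"
proof -
  let ?F = "side_facets i"
  let ?adj = "\<lambda>y z. \<exists>u\<in>{0..1}. gap (g u) y = 0 \<and> gap (g u) z = 0"
  define W where "W xs \<longleftrightarrow> xs \<noteq> [] \<and> set xs \<subseteq> ?F \<and> successively ?adj xs \<and>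
     2 + gap A (hd xs) + gap B (last xs) \<le> l" for xs
  have ends: "g 0 = A" "g 1 = B" using assms by (auto simp: pathstart_def pathfinish_def)
  have steps: "infnorm (g u - A) + infnorm (g v - g u) + infnorm (B - g v) \<le> l"
    if "0 \<le> u" "u \<le> v" "v \<le> 1" for u v
    using arc_length_ge_three_steps[OF that, of g] l ends by simp
  have start_le: "gap A y \<le> infnorm (g u - A)" if "y \<in> ?F" "gap (g u) y = 0" for u y
    using gap_diff_le_infnorm[OF that(1), of "g u" A] that(2) by simp
  have finish_le: "gap B y \<le> infnorm (B - g u)" if "y \<in> ?F" "gap (g u) y = 0" for u y
    using gap_diff_le_infnorm[OF that(1), of B "g u"] that(2) by simp
  have through: "2 + gap A y + gap B z \<le> l"
    if "0 \<le> u" "u \<le> v" "v \<le> 1" "y \<in> ?F" "z \<in> ?F" "gap (g u) y = 0" "gap (g v) z = 0"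
      "2 \<le> infnorm (g v - g u)" for u v y z
    using steps[of u v] start_le[of y u] finish_le[of z v] that by linarith
  have adj: "gap A z + gap B y \<le> l" if yz: "y \<in> ?F" "z \<in> ?F" "?adj y z" for y z
  proof -
    obtain u where "u \<in> {0..1}" "gap (g u) y = 0" "gap (g u) z = 0" using yz by blast
    then show ?thesis
      using steps[of u u] start_le[of z u] finish_le[of y u] yz by (simp add: infnorm_0)
  qed
  have "\<exists>xs. W xs"
  proof -
    have "pathstart g $ i = 1" "pathfinish g $ i = - 1" using assms by auto
    then obtain s t xs where
      st: "0 \<le> s" "s \<le> t" "t \<le> 1" "g s $ i = 1" "g t $ i = - 1" and
      xs: "xs \<noteq> []" "set xs \<subseteq> ?F" "gap (g s) (hd xs) = 0" "gap (g t) (last xs) = 0"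
        "successively ?adj xs"
      by (rule ex_facet_walk[OF assms(1,2)])
    have "2 \<le> infnorm (g t - g s)"
      using component_le_infnorm_cart[of "g t - g s" i] st by simp
    then have "2 + gap A (hd xs) + gap B (last xs) \<le> l"
      using xs st by (intro through[of s t]) auto
    then show ?thesis using xs unfolding W_def by blast
  qed
  then obtain xs where W: "W xs" and min: "\<And>ys. W ys \<Longrightarrow> length xs \<le> length ys"
    using ex_has_least_nat[of W _ length] by blast
  have F: "set xs \<subseteq> ?F" and succ: "successively ?adj xs" and ne: "xs \<noteq> []"
    and ineq: "2 + gap A (hd xs) + gap B (last xs) \<le> l"
    using W by (auto simp: W_def)
  have "distinct (map fst xs)"
  proof (rule ccontr)
    assume "\<not> distinct (map fst xs)"
    then obtain as bs cs j where "map fst xs = as @ [j] @ bs @ [j] @ cs"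
      using not_distinct_decomp by blast
    then obtain ys y zs z ws where xs: "xs = ys @ [y] @ zs @ [z] @ ws" and yz: "fst y = fst z"
      by (fastforce simp: map_eq_append_conv append_eq_map_conv Cons_eq_map_conv)
    have yzF: "y \<in> ?F" "z \<in> ?F" using F xs by auto
    show False
    proof (cases "y = z")
      case True
      have "W (ys @ [y] @ ws)"
        using W unfolding W_def xs True
        by (auto simp: successively_append_iff successively_Cons hd_append split: if_splits)
      then show False using min[of "ys @ [y] @ ws"] xs by simp
    next
      case False
      have opp: "gap x z = 2 - gap x y" for x
        using side_facets_opposite[OF yzF yz False] by simp
      have "zs \<noteq> []"
      proof
        assume "zs = []"
        then have "?adj y z" using succ xs by (auto simp: successively_append_iff)
        then show False using opp by auto
      qed
      have "?adj y (hd zs)" "?adj (last zs) z" and szs: "successively ?adj zs"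
        using succ \<open>zs \<noteq> []\<close> unfolding xs
        by (auto simp: successively_append_iff successively_Cons hd_append split: if_splits)
      then obtain u v where u: "u \<in> {0..1}" "gap (g u) y = 0" "gap (g u) (hd zs) = 0"
        and v: "v \<in> {0..1}" "gap (g v) (last zs) = 0" "gap (g v) z = 0" by blast
      have zsF: "set zs \<subseteq> ?F" "hd zs \<in> ?F" "last zs \<in> ?F" using F xs \<open>zs \<noteq> []\<close> by auto
      have "gap (g v) y = 2" using opp[of "g v"] v by simp
      then have far: "2 \<le> infnorm (g v - g u)"
        using gap_diff_le_infnorm[OF yzF(1), of "g v" "g u"] u by simp
      have "length zs < length xs" using xs by simp
      show False
      proof (cases "u \<le> v")
        case True
        have "2 + gap A (hd zs) + gap B (last zs) \<le> l"
          by (rule through[of u v]) (use u v True zsF far in auto)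
        then have "W zs" using szs zsF \<open>zs \<noteq> []\<close> by (simp add: W_def)
        then show False using min[of zs] \<open>length zs < length xs\<close> by simp
      next
        case nle: False
        have "2 + gap A (last zs) + gap B (hd zs) \<le> l"
          by (rule through[of v u]) (use u v nle zsF far in \<open>auto simp: infnorm_sub\<close>)
        moreover have "successively ?adj (rev zs)"
          using szs by (simp add: conj_commute)
        ultimately have "W (rev zs)"
          using zsF \<open>zs \<noteq> []\<close> by (simp add: W_def hd_rev last_rev)
        then show False using min[of "rev zs"] \<open>length zs < length xs\<close> by simp
      qed
    qed
  qed
  moreover have "successively (\<lambda>y z. gap A z + gap B y \<le> l) xs"
    using succ by (rule successively_mono) (use F adj in blast)
  ultimately show ?thesis
    using F ne ineq by (auto simp: facet_chain_def chain_within_def)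
qed


section \<open>A shortest optimal chain is realised by an admissible path\<close>

text \<open>The function \<open>f\<close> agrees with an affine function on the interval from \<open>c\<close> to \<open>d\<close>.\<close>

definition affine_between :: "(real \<Rightarrow> real) \<Rightarrow> real \<Rightarrow> real \<Rightarrow> bool" where
  "affine_between f c d \<longleftrightarrow> (\<exists>a b. \<forall>x\<in>{c..d}. f x = a + b * x)"

lemma affine_betweenI: "(\<And>x. c \<le> x \<Longrightarrow> x \<le> d \<Longrightarrow> f x = a + b * x) \<Longrightarrow> affine_between f c d"
  by (auto simp: affine_between_def)

lemma affine_between_scale_shift:
  assumes "affine_between f c d"
  shows "affine_between (\<lambda>x. p * (q + r * f x)) c d"
proof -
  obtain a b where "\<forall>x\<in>{c..d}. f x = a + b * x"
    using assms unfolding affine_between_def by blast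
  then show ?thesis
    by (intro affine_betweenI[where a = "p * (q + r * a)" and b = "p * r * b"])
       (simp add: algebra_simps)
qed

text \<open>A common affine parametrisation of all coordinates traces out a segment.\<close>

lemma image_affine_between_eq_closed_segment:
  fixes h :: "real \<Rightarrow> real ^ 'n"
  assumes "c \<le> d" and "\<And>j. affine_between (\<lambda>x. h x $ j) c d"
  shows "h ` {c..d} = closed_segment (h c) (h d)"
proof -
  from assms(2) obtain a b where ab: "\<And>j x. x \<in> {c..d} \<Longrightarrow> h x $ j = a j + b j * x"
    unfolding affine_between_def by metis
  have "h ((1 - w) * c + w * d) = (1 - w) *\<^sub>R h c + w *\<^sub>R h d" if "0 \<le> w" "w \<le> 1" for w
  proof -
    have "(1 - w) *\<^sub>R c + w *\<^sub>R d \<in> closed_segment c d"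
      using that unfolding closed_segment_def by blast
    then have "(1 - w) * c + w * d \<in> {c..d}"
      using assms(1) by (simp add: closed_segment_eq_real_ivl)
    then show ?thesis
      using assms(1) by (simp add: vec_eq_iff ab algebra_simps)
  qed
  moreover have "{c..d} = (\<lambda>w. (1 - w) * c + w * d) ` {0..1}"
    using closed_segment_image_interval[of c d] assms(1)
    by (simp add: closed_segment_eq_real_ivl algebra_simps)
  ultimately show ?thesis
    by (auto simp: closed_segment_image_interval image_image)
qed

text \<open>The gap between the moving point and a facet that it has to visit, as a function of time, for
  \<open>u \<le> t \<le> D - v\<close>: it decreases from \<open>u\<close> at unit speed,
  is 0 between the times \<open>u\<close> and \<open>t\<close>, and then grows linearly to \<open>v\<close> at time \<open>D\<close>.\<close>

definition gap_profile :: "real \<Rightarrow> real \<Rightarrow> real \<Rightarrow> real \<Rightarrow> real \<Rightarrow> real" where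
  "gap_profile u v t D x = max 0 (u - x) + v / (D - t) * max 0 (x - t)"

lemma gap_profile_simps:
  assumes "0 \<le> u" "0 \<le> v" "u \<le> t" "t \<le> D - v"
  shows "x \<le> u \<Longrightarrow> gap_profile u v t D x = u - x"
    and "u \<le> x \<Longrightarrow> x \<le> t \<Longrightarrow> gap_profile u v t D x = 0"
    and "t \<le> x \<Longrightarrow> gap_profile u v t D x = v / (D - t) * (x - t)"
  using assms by (auto simp: gap_profile_def)

lemma continuous_on_gap_profile: "continuous_on S (gap_profile u v t D)"
proof -
  have "continuous_on S (\<lambda>x. max 0 (u - x) + c * max 0 (x - t))" for c
    by (intro continuous_intros)
  then show ?thesis by (simp only: gap_profile_def[abs_def])
qed

lemma gap_profile_ends:
  assumes "0 \<le> u" "0 \<le> v" "u \<le> t" "t \<le> D - v"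
  shows "gap_profile u v t D 0 = u" "gap_profile u v t D D = v"
  using assms by (auto simp: gap_profile_def)

lemma mult_between_0_self:
  fixes c M :: real
  assumes "0 \<le> c" "c \<le> 1" "0 \<le> M"
  shows "0 \<le> c * M" "c * M \<le> M"
  using assms by (simp_all add: mult_left_le_one_le)

lemma gap_profile_slope:
  fixes v t D :: real
  assumes "0 \<le> v" "t \<le> D - v"
  shows "0 \<le> v / (D - t)" "v / (D - t) \<le> 1"
  using assms by (auto simp: divide_le_eq_1)

lemma gap_profile_bounds:
  assumes "0 \<le> u" "u \<le> 2" "0 \<le> v" "v \<le> 2" "u \<le> t" "t \<le> D - v" "0 \<le> x" "x \<le> D"
  shows "0 \<le> gap_profile u v t D x" "gap_profile u v t D x \<le> 2"
    and "gap_profile u v t D x = 2 \<Longrightarrow> x = 0 \<and> u = 2 \<or> x = D \<and> v = 2"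
proof -
  note s = gap_profile_simps[OF assms(1,3,5,6), of x]
  have late: "v / (D - t) * (x - t) \<le> v" if "t \<le> x"
  proof -
    have "v / (D - t) * (x - t) \<le> v / (D - t) * (D - t)"
      using assms that by (intro mult_left_mono) auto
    then show ?thesis using assms by (cases "t = D") auto
  qed
  have late0: "0 \<le> v / (D - t) * (x - t)" if "t \<le> x"
    using assms that by simp
  show "0 \<le> gap_profile u v t D x" "gap_profile u v t D x \<le> 2"
    using s late late0 assms by (smt (verit))+
  show "x = 0 \<and> u = 2 \<or> x = D \<and> v = 2" if two: "gap_profile u v t D x = 2"
  proof (cases "t < x")
    case True
    then have e: "v / (D - t) * (x - t) = 2" using s two by simp
    then have "v = 2" using late True assms by simp
    moreover have "x = D" using e True \<open>v = 2\<close> assms by (simp add: field_simps)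
    ultimately show ?thesis by simp
  next
    case False
    then show ?thesis using s two assms by (smt (verit))
  qed
qed

lemma gap_profile_eq_0_iff:
  assumes "0 \<le> u" "0 \<le> v" "u \<le> t" "t \<le> D - v" "v = 0 \<Longrightarrow> t = D" "x \<le> D"
  shows "gap_profile u v t D x = 0 \<longleftrightarrow> u \<le> x \<and> x \<le> t"
proof -
  note s = gap_profile_simps[OF assms(1-4), of x]
  have "v / (D - t) * (x - t) \<noteq> 0" if "t < x"
    using assms that by auto
  then show ?thesis using s assms(3) by (smt (verit))
qed

lemma gap_profile_lipschitz:
  assumes "0 \<le> u" "0 \<le> v" "u \<le> t" "t \<le> D - v" "x \<le> y"
  shows "\<bar>gap_profile u v t D y - gap_profile u v t D x\<bar> \<le> y - x"
proof -
  let ?c = "v / (D - t)" and ?M = "\<lambda>x. max 0 (x - t)"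
  have M: "0 \<le> ?M y - ?M x" using assms by simp
  have c: "0 \<le> ?c * (?M y - ?M x)" "?c * (?M y - ?M x) \<le> ?M y - ?M x"
    using mult_between_0_self[OF gap_profile_slope[OF assms(2,4)] M] by blast+
  have e: "gap_profile u v t D y - gap_profile u v t D x
      = max 0 (u - y) - max 0 (u - x) + ?c * (?M y - ?M x)"
    by (simp add: gap_profile_def algebra_simps)
  have "max 0 (u - y) - max 0 (u - x) + (?M y - ?M x) \<le> y - x"
    "x - y \<le> max 0 (u - y) - max 0 (u - x)"
    "max 0 (u - y) - max 0 (u - x) \<le> 0"
    using assms by auto
  moreover have "\<bar>p + q\<bar> \<le> r"
    if "p + w \<le> r" "- r \<le> p" "p \<le> 0" "0 \<le> q" "q \<le> w" for p q w r :: real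
    using that by linarith
  ultimately show ?thesis unfolding e using c by (metis minus_diff_eq)
qed

lemma gap_profile_affine:
  assumes "0 \<le> u" "0 \<le> v" "u \<le> t" "t \<le> D - v"
    and "d \<le> u \<or> u \<le> c \<and> d \<le> t \<or> t \<le> c"
  shows "affine_between (gap_profile u v t D) c d"
proof -
  note s = gap_profile_simps[OF assms(1-4)]
  from assms(5) show ?thesis
  proof (elim disjE conjE)
    assume "d \<le> u"
    then show ?thesis
      by (intro affine_betweenI[where a = u and b = "-1"]) (simp add: s)
  next
    assume "u \<le> c" "d \<le> t"
    then show ?thesis
      by (intro affine_betweenI[where a = 0 and b = 0]) (simp add: s)
  next
    assume "t \<le> c"
    then show ?thesis
      by (intro affine_betweenI[where a = "- (v / (D - t)) * t" and b = "v / (D - t)"])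
         (simp add: s right_diff_distrib)
  qed
qed

text \<open>The coordinate which has to change sign: 1 up to time \<open>t\<close>, -1 from time \<open>t'\<close> on, and
  linear in between.\<close>

definition crossing :: "real \<Rightarrow> real \<Rightarrow> real \<Rightarrow> real" where
  "crossing t t' x = 1 - 2 / (t' - t) * (max 0 (x - t) - max 0 (x - t'))"

lemma crossing_simps:
  assumes "t + 2 \<le> t'"
  shows "x \<le> t \<Longrightarrow> crossing t t' x = 1"
    and "t \<le> x \<Longrightarrow> x \<le> t' \<Longrightarrow> crossing t t' x = 1 - 2 / (t' - t) * (x - t)"
    and "t' \<le> x \<Longrightarrow> crossing t t' x = - 1"
proof -
  have c: "2 / (t' - t) * (t' - t) = 2"
    using assms nonzero_mult_div_cancel_right[of "t' - t" 2] by (simp only: times_divide_eq_left)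
  show "x \<le> t \<Longrightarrow> crossing t t' x = 1"
    "t \<le> x \<Longrightarrow> x \<le> t' \<Longrightarrow> crossing t t' x = 1 - 2 / (t' - t) * (x - t)"
    using assms by (auto simp: crossing_def)
  show "crossing t t' x = - 1" if "t' \<le> x"
  proof -
    have "max 0 (x - t) - max 0 (x - t') = t' - t" using assms that by auto
    then show ?thesis unfolding crossing_def using c by simp
  qed
qed

lemma crossing_cases:
  assumes "t + 2 \<le> t'"
  shows "\<bar>crossing t t' x\<bar> \<le> 1" "crossing t t' x = 1 \<longleftrightarrow> x \<le> t" "crossing t t' x = - 1 \<longleftrightarrow> t' \<le> x"
proof -
  note s = crossing_simps[OF assms, of x]
  have "0 < 2 / (t' - t) * (x - t)" "2 / (t' - t) * (x - t) < 2" if "t < x" "x < t'"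
    using assms that by (auto simp: field_simps)
  then show "\<bar>crossing t t' x\<bar> \<le> 1" "crossing t t' x = 1 \<longleftrightarrow> x \<le> t"
    "crossing t t' x = - 1 \<longleftrightarrow> t' \<le> x"
    using s by (smt (verit))+
qed

lemma crossing_lipschitz:
  assumes "t + 2 \<le> t'" "x \<le> y"
  shows "\<bar>crossing t t' y - crossing t t' x\<bar> \<le> y - x"
proof -
  let ?M = "\<lambda>x. max 0 (x - t) - max 0 (x - t')" and ?c = "2 / (t' - t)"
  have M: "0 \<le> ?M y - ?M x" "?M y - ?M x \<le> y - x" using assms by auto
  have "0 \<le> ?c" "?c \<le> 1" using assms by auto
  then have "0 \<le> ?c * (?M y - ?M x)" "?c * (?M y - ?M x) \<le> ?M y - ?M x"
    using mult_between_0_self[OF _ _ M(1)] by blast+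
  moreover have "crossing t t' y - crossing t t' x = - (?c * (?M y - ?M x))"
    by (simp add: crossing_def algebra_simps)
  ultimately show ?thesis using M by linarith
qed

lemma crossing_affine:
  assumes "t + 2 \<le> t'" "d \<le> t \<or> t \<le> c \<and> d \<le> t' \<or> t' \<le> c"
  shows "affine_between (crossing t t') c d"
proof -
  note s = crossing_simps[OF assms(1)]
  from assms(2) show ?thesis
  proof (elim disjE conjE)
    assume "d \<le> t"
    then show ?thesis
      by (intro affine_betweenI[where a = 1 and b = 0]) (simp add: s)
  next
    assume "t \<le> c" "d \<le> t'"
    then show ?thesis
      by (intro affine_betweenI[where a = "1 + 2 / (t' - t) * t" and b = "- (2 / (t' - t))"])
         (simp add: s right_diff_distrib)
  next
    assume "t' \<le> c"
    then show ?thesis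
      by (intro affine_betweenI[where a = "-1" and b = 0]) (simp add: s)
  qed
qed

text \<open>The data of the construction: \<open>D\<close> is the smallest value of a chain and \<open>xs\<close> is as short as
  possible among the chains of value \<open>D\<close>.\<close>

locale shortest_optimal_chain =
  fixes A B :: "real ^ 'n" and i :: 'n and xs :: "('n \<times> real) list" and D :: real
  assumes A: "A \<in> sup_sphere" "A $ i = 1" and B: "B \<in> sup_sphere" "B $ i = - 1"
    and chain: "facet_chain i xs" and within: "chain_within A B xs D"
    and optimal: "\<And>ys d. facet_chain i ys \<Longrightarrow> chain_within A B ys d \<Longrightarrow> D \<le> d"
    and shortest: "\<And>ys. facet_chain i ys \<Longrightarrow> chain_within A B ys D \<Longrightarrow> length xs \<le> length ys"
begin

abbreviation m :: nat where "m \<equiv> length xs"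

abbreviation \<alpha> :: "nat \<Rightarrow> real" where "\<alpha> k \<equiv> gap A (xs ! k)"

abbreviation \<beta> :: "nat \<Rightarrow> real" where "\<beta> k \<equiv> gap B (xs ! k)"

lemma m_pos: "0 < m" and xs_ne: "xs \<noteq> []"
  using chain by (auto simp: facet_chain_def)

lemma nth_side_facet: "k < m \<Longrightarrow> xs ! k \<in> side_facets i"
  using chain by (auto simp: facet_chain_def)

lemma sign: "k < m \<Longrightarrow> snd (xs ! k) \<in> {1, - 1}" and fst_ne: "k < m \<Longrightarrow> fst (xs ! k) \<noteq> i"
  using nth_side_facet[of k] by (auto simp: side_facets_def)

lemma alpha_bounds: "k < m \<Longrightarrow> 0 \<le> \<alpha> k" "k < m \<Longrightarrow> \<alpha> k \<le> 2"
  and beta_bounds: "k < m \<Longrightarrow> 0 \<le> \<beta> k" "k < m \<Longrightarrow> \<beta> k \<le> 2"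
  using gap_bounds[OF nth_side_facet] A B by auto

lemma ends_le: "2 + \<alpha> 0 + \<beta> (m - 1) \<le> D"
  using within xs_ne by (simp add: chain_within_def hd_conv_nth last_conv_nth)

lemma step_le: "Suc k < m \<Longrightarrow> \<alpha> (Suc k) + \<beta> k \<le> D"
  using within by (auto simp: chain_within_def successively_conv_nth)

lemma omit_not_within:
  assumes "k < m" "2 \<le> m"
  shows "\<not> chain_within A B (take k xs @ drop (Suc k) xs) D"
proof
  let ?ys = "take k xs @ drop (Suc k) xs"
  assume within': "chain_within A B ?ys D"
  have len: "length ?ys = m - 1" using assms by simp
  have "set ?ys \<subseteq> set xs"
    using set_take_subset[of k xs] set_drop_subset[of "Suc k" xs] by simp
  moreover have "distinct (map fst ?ys)"
    using chain set_take_disj_set_drop_if_distinct[of "map fst xs" k "Suc k"]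
    by (simp add: facet_chain_def take_map[symmetric] drop_map[symmetric])
  moreover have "?ys \<noteq> []" using len assms by auto
  ultimately have "facet_chain i ?ys"
    using chain unfolding facet_chain_def by blast
  then have "m \<le> length ?ys" using within' by (rule shortest)
  then show False using len assms by simp
qed

text \<open>As \<open>xs\<close> is shortest, omitting one facet violates the only inequality which is then new.
  Compared with the inequalities of \<open>xs\<close> itself, this shows that the gaps from \<open>A\<close> increase along
  the chain and the gaps to \<open>B\<close> decrease.\<close>

lemma omit_first: assumes "2 \<le> m" shows "D < 2 + \<alpha> 1 + \<beta> (m - 1)"
proof -
  have "last (drop 1 xs) = last xs" "hd (drop 1 xs) = xs ! 1"
    using assms by (auto simp: last_drop hd_drop_conv_nth)
  moreover have "successively (\<lambda>y z. gap A z + gap B y \<le> D) (drop 1 xs)"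
    using within by (auto simp: chain_within_def successively_conv_nth)
  ultimately show ?thesis
    using omit_not_within[of 0] assms last_conv_nth[OF xs_ne] xs_ne by (simp add: chain_within_def)
qed

lemma omit_last: assumes "2 \<le> m" shows "D < 2 + \<alpha> 0 + \<beta> (m - 2)"
proof -
  have "last (take (m - 1) xs) = xs ! (m - 2)" "hd (take (m - 1) xs) = xs ! 0"
    using assms xs_ne by (auto simp: last_conv_nth hd_conv_nth nth_take numeral_2_eq_2)
  moreover have "successively (\<lambda>y z. gap A z + gap B y \<le> D) (take (m - 1) xs)"
    using within by (auto simp: chain_within_def successively_conv_nth)
  ultimately show ?thesis
    using omit_not_within[of "m - 1"] assms m_pos by (simp add: chain_within_def)
qed

lemma omit_inner: assumes "Suc (Suc k) < m" shows "D < \<alpha> (Suc (Suc k)) + \<beta> k"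
proof (rule ccontr)
  let ?a = "take (Suc k) xs" and ?b = "drop (Suc (Suc k)) xs"
  assume "\<not> ?thesis"
  moreover have "?a \<noteq> []" "?b \<noteq> []" using assms by auto
  moreover have "last ?a = xs ! k" "hd ?b = xs ! Suc (Suc k)"
    using assms \<open>?a \<noteq> []\<close> by (auto simp: last_conv_nth hd_drop_conv_nth)
  moreover have "hd ?a = hd xs" "last ?b = last xs"
    using assms by (auto simp: last_drop)
  moreover have "successively (\<lambda>y z. gap A z + gap B y \<le> D) ?a"
    "successively (\<lambda>y z. gap A z + gap B y \<le> D) ?b"
    using within assms by (auto simp: chain_within_def successively_conv_nth)
  ultimately have "chain_within A B (?a @ ?b) D"
    using within unfolding chain_within_def successively_append_iff by simp
  then show False using omit_not_within[of "Suc k"] assms by simp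
qed

lemma alpha_less: assumes "Suc k < m" shows "\<alpha> k < \<alpha> (Suc k)"
proof (cases k)
  case 0
  then show ?thesis using omit_first ends_le assms by simp
next
  case (Suc l)
  then show ?thesis using omit_inner[of l] step_le[of l] assms by simp
qed

lemma beta_less: assumes "Suc k < m" shows "\<beta> (Suc k) < \<beta> k"
proof (cases "Suc (Suc k) < m")
  case True
  then show ?thesis using omit_inner[of k] step_le[of "Suc k"] by simp
next
  case False
  then have "m = Suc (Suc k)" using assms by simp
  then show ?thesis using omit_last ends_le by simp
qed

lemma alpha_last_less: "\<alpha> (m - 1) < D - \<beta> (m - 1)"
proof (cases "m = 1")
  case True
  then show ?thesis using ends_le by simp
next
  case False
  then have "2 \<le> m" using m_pos by linarith
  then have "Suc (m - 2) < m" "Suc (m - 2) = m - 1" by auto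
  then show ?thesis using step_le[of "m - 2"] omit_last[OF \<open>2 \<le> m\<close>] ends_le by simp
qed

text \<open>The path to be constructed is on the facet \<open>xs ! k\<close> exactly from time \<open>\<tau> k\<close>, the earliest one
  possible, to time \<open>\<tau> (k + 1)\<close>. The last facet is left as late as possible.\<close>

definition \<tau> :: "nat \<Rightarrow> real" where
  "\<tau> k = (if k < m then \<alpha> k else D - \<beta> (m - 1))"

lemma tau_Suc: assumes "k < m" shows "\<tau> k < \<tau> (Suc k)"
proof (cases "Suc k < m")
  case False
  then have "k = m - 1" using assms by simp
  then show ?thesis using alpha_last_less m_pos by (simp add: \<tau>_def)
qed (simp add: \<tau>_def alpha_less)

lemma tau_mono: assumes "k \<le> l" "l \<le> m" shows "\<tau> k \<le> \<tau> l"
  using assms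
proof (induction l rule: dec_induct)
  case (step l)
  then show ?case using tau_Suc[of l] by simp
qed simp

lemma tau_0: "0 \<le> \<tau> 0" and tau_m: "\<tau> m \<le> D" and tau_0_m: "\<tau> 0 + 2 \<le> \<tau> m"
  using alpha_bounds(1)[of 0] beta_bounds(1)[of "m - 1"] m_pos ends_le by (auto simp: \<tau>_def)

lemma D_ge_2: "2 \<le> D"
  using tau_0 tau_m tau_0_m by simp

lemma alpha_le_tau: "k < m \<Longrightarrow> \<alpha> k \<le> \<tau> (Suc k)"
  using tau_Suc[of k] by (simp add: \<tau>_def)

lemma tau_le_beta: assumes "k < m" shows "\<tau> (Suc k) \<le> D - \<beta> k"
proof (cases "Suc k < m")
  case True
  then show ?thesis using step_le[of k] by (simp add: \<tau>_def)
next
  case False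
  then have "k = m - 1" using assms by simp
  then show ?thesis using m_pos by (simp add: \<tau>_def)
qed

lemma beta_eq_0: assumes "k < m" "\<beta> k = 0" shows "\<tau> (Suc k) = D"
proof -
  have "\<not> Suc k < m" using beta_less[of k] beta_bounds(1)[of "Suc k"] assms by auto
  moreover from this have "k = m - 1" using assms by simp
  ultimately show ?thesis using assms by (simp add: \<tau>_def)
qed

text \<open>A side facet that contains both \<open>A\<close> and \<open>B\<close> is by itself a chain of value 2.\<close>

lemma common_facet:
  assumes "j \<noteq> i" "s \<in> {1, -1}" "A $ j = s" "B $ j = s"
  shows "D = 2" "m = 1" "\<tau> 0 = 0" "\<tau> m = D"
proof -
  have c: "facet_chain i [(j, - s)]" "chain_within A B [(j, - s)] 2"
    using assms by (auto simp: facet_chain_def side_facets_def chain_within_def gap_def)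
  then show D: "D = 2" using optimal D_ge_2 by force
  then have "m \<le> 1" using shortest[OF c(1)] c(2) by simp
  then show "m = 1" using m_pos by linarith
  show "\<tau> 0 = 0" "\<tau> m = D"
    using D tau_0 tau_m tau_0_m by auto
qed

text \<open>The position of coordinate \<open>j\<close> in the chain; it is used only if \<open>j\<close> occurs there.\<close>

definition index :: "'n \<Rightarrow> nat" where
  "index j = (THE k. k < m \<and> fst (xs ! k) = j)"

lemma index_eq: assumes "k < m" shows "index (fst (xs ! k)) = k"
  unfolding index_def
proof (rule the_equality)
  fix l assume "l < m \<and> fst (xs ! l) = fst (xs ! k)"
  then show "l = k"
    using chain assms nth_eq_iff_index_eq[of "map fst xs" l k] by (simp add: facet_chain_def)
qed (use assms in simp)

text \<open>The gap to the facet \<open>xs ! k\<close> as a function of time.\<close>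

definition profile :: "nat \<Rightarrow> real \<Rightarrow> real" where
  "profile k = gap_profile (\<alpha> k) (\<beta> k) (\<tau> (Suc k)) D"

text \<open>The path, parametrised by the time from 0 to \<open>D\<close>. A gap \<open>q\<close> to the facet \<open>(j, e)\<close> means that
  coordinate \<open>j\<close> is \<open>- e (1 - q)\<close>; this is written so as to match the affine form
  \<open>p (q + r f)\<close>. Coordinates other than \<open>i\<close> that do not occur in the chain move linearly from their
  value in \<open>A\<close> to that in \<open>B\<close>.\<close>

definition h :: "real \<Rightarrow> real ^ 'n" where
  "h x = (\<chi> j. if j = i then crossing (\<tau> 0) (\<tau> m) x
     else if j \<in> fst ` set xs then - snd (xs ! index j) * (1 + - 1 * profile (index j) x)
     else A $ j + (B $ j - A $ j) / D * x)"

lemma h_cases: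
  obtains (cross) "j = i" "\<And>x. h x $ j = crossing (\<tau> 0) (\<tau> m) x"
  | (chain) k where "k < m" "j = fst (xs ! k)" "j \<noteq> i"
      "\<And>x. h x $ j = - snd (xs ! k) * (1 + - 1 * profile k x)"
  | (other) "j \<noteq> i" "\<And>x. h x $ j = A $ j + (B $ j - A $ j) / D * x"
proof (cases "j = i")
  case True
  then show ?thesis using cross by (simp add: h_def)
next
  case False
  show ?thesis
  proof (cases "j \<in> fst ` set xs")
    case True
    then obtain k where "k < m" "j = fst (xs ! k)" by (auto simp: in_set_conv_nth)
    then show ?thesis using chain[of k] False True index_eq by (simp add: h_def)
  next
    case f: False
    then show ?thesis using other False by (simp add: h_def)
  qed
qed

lemma h_nth:
  assumes "k < m"
  shows "h x $ fst (xs ! k) = - snd (xs ! k) * (1 + - 1 * profile k x)"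
  using fst_ne[OF assms] assms index_eq[OF assms] by (auto simp: h_def)

lemma sphere_abs_le: "\<bar>A $ j\<bar> \<le> 1" "\<bar>B $ j\<bar> \<le> 1"
  using A B by (auto simp: mem_sup_sphere_iff)

lemmas profile_hyps = alpha_bounds(1) beta_bounds(1) alpha_le_tau tau_le_beta
lemmas profile_hyps2 = alpha_bounds(1,2) beta_bounds(1,2) alpha_le_tau tau_le_beta

lemma h_0: "h 0 = A" and h_D: "h D = B"
proof -
  have "h 0 $ j = A $ j \<and> h D $ j = B $ j" for j
  proof (cases j rule: h_cases)
    case cross
    then show ?thesis
      using crossing_simps[OF tau_0_m] tau_0 tau_m A B by simp
  next
    case (chain k)
    then show ?thesis
      using gap_profile_ends[OF profile_hyps, of k] sign[of k]
      by (auto simp: profile_def gap_def)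
  next
    case other
    then show ?thesis using D_ge_2 by simp
  qed
  then show "h 0 = A" "h D = B" by (auto simp: vec_eq_iff)
qed

lemma h_abs_le_1: assumes "0 \<le> x" "x \<le> D" shows "\<bar>h x $ j\<bar> \<le> 1"
proof (cases j rule: h_cases)
  case cross
  then show ?thesis using crossing_cases[OF tau_0_m] by simp
next
  case (chain k)
  then show ?thesis
    using gap_profile_bounds(1,2)[OF profile_hyps2 assms, of k] sign[of k]
    by (auto simp: profile_def abs_if)
next
  case other
  have "x / D \<in> {0..1}" using assms D_ge_2 by auto
  moreover have "h x $ j = (1 - x / D) * A $ j + x / D * B $ j"
    unfolding other(2) using D_ge_2 by (simp add: diff_divide_distrib algebra_simps)
  moreover have "\<bar>(1 - l) * A $ j + l * B $ j\<bar> \<le> 1" if "l \<in> {0..1}" for l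
  proof -
    have "\<bar>(1 - l) * A $ j + l * B $ j\<bar> \<le> \<bar>(1 - l) * A $ j\<bar> + \<bar>l * B $ j\<bar>"
      by (rule abs_triangle_ineq)
    also have "\<dots> \<le> (1 - l) + l"
      using that sphere_abs_le[of j]
      by (intro add_mono) (auto simp: abs_mult intro!: mult_left_le)
    finally show ?thesis by simp
  qed
  ultimately show ?thesis by metis
qed

lemma h_on_facet_iff:
  assumes "k < m" "x \<le> D"
  shows "h x $ fst (xs ! k) = - snd (xs ! k) \<longleftrightarrow> \<tau> k \<le> x \<and> x \<le> \<tau> (Suc k)"
proof -
  have "profile k x = 0 \<longleftrightarrow> \<tau> k \<le> x \<and> x \<le> \<tau> (Suc k)"
    using gap_profile_eq_0_iff[OF profile_hyps beta_eq_0, of k x] assms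
    by (simp add: profile_def \<tau>_def)
  then show ?thesis using h_nth[OF assms(1), of x] sign[OF assms(1)] by auto
qed

lemma ex_time_interval:
  assumes "\<tau> 0 \<le> x" "x \<le> \<tau> l" "l \<le> m"
  shows "x = \<tau> 0 \<or> (\<exists>k<l. \<tau> k \<le> x \<and> x \<le> \<tau> (Suc k))"
  using assms
proof (induction l)
  case (Suc l)
  then show ?case by (cases "x \<le> \<tau> l") (auto simp: less_Suc_eq)
qed auto

lemma h_in_sup_sphere: assumes "0 \<le> x" "x \<le> D" shows "h x \<in> sup_sphere"
proof -
  have "\<exists>j. \<bar>h x $ j\<bar> = 1"
  proof (cases "x \<le> \<tau> 0 \<or> \<tau> m \<le> x")
    case True
    then have "\<bar>h x $ i\<bar> = 1"
      using crossing_simps[OF tau_0_m, of x] by (auto simp: h_def)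
    then show ?thesis ..
  next
    case False
    then obtain k where "k < m" "\<tau> k \<le> x" "x \<le> \<tau> (Suc k)"
      using ex_time_interval[of x m] by auto
    then have "\<bar>h x $ fst (xs ! k)\<bar> = 1"
      using h_on_facet_iff[of k x] assms sign[of k] by auto
    then show ?thesis ..
  qed
  then show ?thesis using h_abs_le_1[OF assms] by (simp add: mem_sup_sphere_iff)
qed

lemma h_lipschitz: assumes "x \<le> y" shows "infnorm (h y - h x) \<le> y - x"
  unfolding infnorm_le_iff_cart
proof
  fix j
  show "\<bar>(h y - h x) $ j\<bar> \<le> y - x"
  proof (cases j rule: h_cases)
    case cross
    then show ?thesis using crossing_lipschitz[OF tau_0_m assms] by simp
  next
    case (chain k)
    have "(h y - h x) $ j = snd (xs ! k) * (profile k y - profile k x)"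
      unfolding vector_minus_component chain(4) by (simp add: algebra_simps)
    then show ?thesis
      using gap_profile_lipschitz[OF profile_hyps assms, of k] sign[of k] chain
      by (auto simp: profile_def)
  next
    case other
    have "\<bar>(B $ j - A $ j) / D\<bar> \<le> 1"
      using sphere_abs_le[of j] D_ge_2 by (auto simp: abs_divide divide_le_eq_1)
    then have "\<bar>(B $ j - A $ j) / D\<bar> * (y - x) \<le> 1 * (y - x)"
      using assms by (intro mult_right_mono) auto
    moreover have "(h y - h x) $ j = (B $ j - A $ j) / D * (y - x)"
      using other by (simp add: right_diff_distrib)
    ultimately show ?thesis using assms by (simp add: abs_mult)
  qed
qed

lemma h_affine:
  assumes "d \<le> \<tau> 0 \<or> (\<exists>k<m. \<tau> k \<le> c \<and> d \<le> \<tau> (Suc k)) \<or> \<tau> m \<le> c"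
  shows "affine_between (\<lambda>x. h x $ j) c d"
proof (cases j rule: h_cases)
  case cross
  have "d \<le> \<tau> 0 \<or> \<tau> 0 \<le> c \<and> d \<le> \<tau> m \<or> \<tau> m \<le> c"
    using assms
  proof (elim disjE exE conjE)
    fix k assume k: "k < m" "\<tau> k \<le> c" "d \<le> \<tau> (Suc k)"
    then show ?thesis using tau_mono[of 0 k] tau_mono[of "Suc k" m] by simp
  qed auto
  then show ?thesis using crossing_affine[OF tau_0_m] cross by simp
next
  case (chain l)
  have "d \<le> \<tau> l \<or> \<tau> l \<le> c \<and> d \<le> \<tau> (Suc l) \<or> \<tau> (Suc l) \<le> c"
    using assms
  proof (elim disjE exE conjE)
    assume "d \<le> \<tau> 0"
    then show ?thesis using tau_mono[of 0 l] chain by simp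
  next
    fix k assume k: "k < m" "\<tau> k \<le> c" "d \<le> \<tau> (Suc k)"
    consider "Suc k \<le> l" | "k = l" | "Suc l \<le> k" by linarith
    then show ?thesis
      using k chain tau_mono[of "Suc k" l] tau_mono[of "Suc l" k] by cases auto
  next
    assume "\<tau> m \<le> c"
    then show ?thesis using tau_mono[of "Suc l" m] chain by simp
  qed
  then have "affine_between (profile l) c d"
    unfolding profile_def
    using chain by (intro gap_profile_affine profile_hyps) (auto simp: \<tau>_def)
  then show ?thesis
    unfolding chain(4) by (rule affine_between_scale_shift)
next
  case other
  then show ?thesis
    by (intro affine_betweenI[where a = "A $ j" and b = "(B $ j - A $ j) / D"])
qed

text \<open>The times which the path spends on a facet form an interval on which it is affine, since the
  \<open>\<tau> k\<close> are the only break points. A side facet outside the chain is met at most in \<open>A\<close> or in \<open>B\<close>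
  alone, unless it contains both; then \<open>D = 2\<close> and the path is the segment from \<open>A\<close> to \<open>B\<close>.\<close>

lemma facet_times:
  assumes s: "s \<in> {1, -1}" and ne: "\<exists>x\<in>{0..D}. h x $ j = s"
  shows "\<exists>c d. c \<le> d \<and> {x\<in>{0..D}. h x $ j = s} = {c..d} \<and>
           (d \<le> \<tau> 0 \<or> (\<exists>k<m. \<tau> k \<le> c \<and> d \<le> \<tau> (Suc k)) \<or> \<tau> m \<le> c)"
    (is "\<exists>c d. ?P c d")
proof -
  have ends: "\<exists>c d. ?P c d"
    if sub: "\<And>x. x \<in> {0..D} \<Longrightarrow> h x $ j = s \<Longrightarrow> x = 0 \<or> x = D"
      and nb: "\<not> (A $ j = s \<and> B $ j = s)"
  proof -
    let ?Z = "{x\<in>{0..D}. h x $ j = s}"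
    have "?Z \<subseteq> {0, D}" using sub by blast
    moreover have "0 \<in> ?Z \<longleftrightarrow> A $ j = s" "D \<in> ?Z \<longleftrightarrow> B $ j = s"
      using h_0 h_D D_ge_2 by auto
    moreover have "?Z \<noteq> {}" using ne by blast
    ultimately have "?Z = {0} \<or> ?Z = {D}" using nb by blast
    then have "?P 0 0 \<or> ?P D D" using tau_0 tau_m by auto
    then show ?thesis by blast
  qed
  show ?thesis
  proof (cases j rule: h_cases)
    case cross
    note c = crossing_cases(2,3)[OF tau_0_m]
    show ?thesis
    proof (cases "s = 1")
      case True
      then have "?P 0 (\<tau> 0)" using cross c tau_0 tau_0_m tau_m by auto
      then show ?thesis by blast
    next
      case False
      then have "?P (\<tau> m) D" using s cross c tau_0 tau_0_m tau_m by auto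
      then show ?thesis by blast
    qed
  next
    case (chain k)
    have t: "0 \<le> \<tau> k" "\<tau> k \<le> \<tau> (Suc k)" "\<tau> (Suc k) \<le> D"
      using tau_0 tau_mono[of 0 k] tau_Suc[of k] tau_mono[of "Suc k" m] tau_m chain(1) by auto
    show ?thesis
    proof (cases "s = - snd (xs ! k)")
      case True
      then have "?P (\<tau> k) (\<tau> (Suc k))"
        using h_on_facet_iff[OF chain(1)] chain(1,2) t by auto
      then show ?thesis by blast
    next
      case False
      then have s': "s = snd (xs ! k)" using s sign[OF chain(1)] by auto
      have two: "profile k x = 2" if "h x $ j = s" for x
        using that chain(4) s' sign[OF chain(1)] by auto
      show ?thesis
      proof (rule ends)
        fix x assume "x \<in> {0..D}" "h x $ j = s"
        then show "x = 0 \<or> x = D"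
          using gap_profile_bounds(3)[OF profile_hyps2, of k x] chain(1) two[of x]
          by (auto simp: profile_def)
      next
        show "\<not> (A $ j = s \<and> B $ j = s)"
        proof
          assume AB: "A $ j = s \<and> B $ j = s"
          then have "\<alpha> k = 2" "\<beta> k = 2"
            using chain s' s by (auto simp: gap_def)
          moreover have "D = 2" using common_facet(1)[OF chain(3) s] AB by blast
          ultimately show False
            using alpha_le_tau[OF chain(1)] tau_le_beta[OF chain(1)] by simp
        qed
      qed
    qed
  next
    case other
    show ?thesis
    proof (cases "A $ j = s \<and> B $ j = s")
      case True
      then have "D = 2" "m = 1" "\<tau> 0 = 0" "\<tau> m = D" using common_facet[OF other(1) s] by auto
      then have "?P 0 D" using other True by auto
      then show ?thesis by blast
    next
      case False
      show ?thesis
      proof (rule ends[OF _ False])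
        fix x assume x: "x \<in> {0..D}" "h x $ j = s"
        define l where "l = x / D"
        have l: "0 \<le> l" "l \<le> 1" using x D_ge_2 by (auto simp: l_def)
        have e: "s = (1 - l) * A $ j + l * B $ j"
          using x(2) unfolding other(2) by (simp add: l_def diff_divide_distrib algebra_simps)
        \<comment> \<open>As \<open>s\<close> is an extreme value, it is not a proper convex combination of other values.\<close>
        have "l = 0 \<or> l = 1"
        proof (rule ccontr)
          assume "\<not> (l = 0 \<or> l = 1)"
          then have l': "0 < l" "0 < 1 - l" using l by auto
          have ab: "0 \<le> 1 - s * A $ j" "0 \<le> 1 - s * B $ j"
            using s sphere_abs_le[of j] by auto
          have "(1 - l) * (1 - s * A $ j) + l * (1 - s * B $ j) = 1 - s * s"
            by (subst (3) e) (simp add: algebra_simps)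
          also have "\<dots> = 0" using s by auto
          finally have "(1 - l) * (1 - s * A $ j) = 0" "l * (1 - s * B $ j) = 0"
            using ab l' by (smt (verit) mult_nonneg_nonneg)+
          then show False using False l' s by auto
        qed
        then show "x = 0 \<or> x = D" using D_ge_2 by (auto simp: l_def)
      qed
    qed
  qed
qed

lemma continuous_on_h: "continuous_on S h"
proof -
  have "continuous_on S (\<lambda>x. h x $ j)" for j
  proof (cases j rule: h_cases)
    case cross
    then show ?thesis using tau_0_m by (auto simp: crossing_def intro!: continuous_intros)
  next
    case (chain k)
    then show ?thesis
      by (auto simp: profile_def intro!: continuous_intros continuous_on_gap_profile)
  next
    case other
    then show ?thesis using D_ge_2 by (auto intro!: continuous_intros)
  qed
  then have "continuous_on S (\<lambda>x. \<chi> j. h x $ j)" by (rule continuous_on_vec_lambda)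
  then show ?thesis by simp
qed

lemma ex_admissible_path: "\<exists>g\<in>admissible_paths A B. arc_length g \<le> ereal D"
proof
  let ?g = "\<lambda>u. h (D * u)"
  have D: "0 < D" using D_ge_2 by simp
  have "(*) D ` {0..1} = {0..D}"
    using D image_mult_atLeastAtMost[of D 0 1] by simp
  then have im: "path_image ?g = h ` {0..D}"
    by (metis image_image path_image_def)
  have facets: "\<exists>P Q. path_image ?g \<inter> facet j s = closed_segment P Q"
    if s: "s \<in> {1, -1}" and ne: "path_image ?g \<inter> facet j s \<noteq> {}" for j s
  proof -
    have eq: "path_image ?g \<inter> facet j s = h ` {x\<in>{0..D}. h x $ j = s}"
      unfolding im facet_def using h_in_sup_sphere by auto
    then have "\<exists>x\<in>{0..D}. h x $ j = s" using ne by auto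
    then obtain c d where "c \<le> d" "{x\<in>{0..D}. h x $ j = s} = {c..d}"
      "d \<le> \<tau> 0 \<or> (\<exists>k<m. \<tau> k \<le> c \<and> d \<le> \<tau> (Suc k)) \<or> \<tau> m \<le> c"
      using facet_times[OF s] by blast
    then show ?thesis
      unfolding eq using image_affine_between_eq_closed_segment[OF _ h_affine] by metis
  qed
  have "path ?g"
    unfolding path_def
    by (intro continuous_on_compose2[OF continuous_on_h[of UNIV]] continuous_intros) auto
  moreover have "path_image ?g \<subseteq> sup_sphere"
    unfolding im using h_in_sup_sphere by auto
  ultimately show "?g \<in> admissible_paths A B"
    using facets by (auto simp: admissible_paths_def pathstart_def pathfinish_def h_0 h_D)
  show "arc_length ?g \<le> ereal D"
  proof (rule arc_length_le_of_lipschitz)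
    fix u v :: real assume "0 \<le> u" "u \<le> v" "v \<le> 1"
    then show "infnorm (h (D * v) - h (D * u)) \<le> D * (v - u)"
      using h_lipschitz[of "D * u" "D * v"] D by (simp add: right_diff_distrib)
  qed (use D in simp)
qed

end


section \<open>The geodesic distance\<close>

text \<open>The value of a chain given by its sequences of coordinates and signs, indexed from 1.\<close>

definition chain_bound :: "real ^ 'n \<Rightarrow> real ^ 'n \<Rightarrow> nat \<Rightarrow> (nat \<Rightarrow> 'n) \<Rightarrow> (nat \<Rightarrow> real) \<Rightarrow> real" where
  "chain_bound A B m p \<epsilon> = Max (insert (4 + \<epsilon> 1 * A $ p 1 + \<epsilon> m * B $ p m)
     ((\<lambda>t. 2 + \<epsilon> (t + 1) * A $ p (t + 1) + \<epsilon> t * B $ p t) ` {1..<m}))"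

text \<open>The sequences over which the minimum is taken; they correspond to the lists with
  \<^const>\<open>facet_chain\<close>, whose length needs no bound because the coordinates are distinct.\<close>

definition indexed_chain :: "('n :: finite) \<Rightarrow> nat \<Rightarrow> (nat \<Rightarrow> 'n) \<Rightarrow> (nat \<Rightarrow> real) \<Rightarrow> bool" where
  "indexed_chain i m p \<epsilon> \<longleftrightarrow> 1 \<le> m \<and> m \<le> CARD('n) - 1 \<and> inj_on p {1..m} \<and>
     p ` {1..m} \<subseteq> UNIV - {i} \<and> \<epsilon> ` {1..m} \<subseteq> {1, -1}"

lemma chain_bound_le_iff:
  "chain_bound A B m p \<epsilon> \<le> d \<longleftrightarrow> 4 + \<epsilon> 1 * A $ p 1 + \<epsilon> m * B $ p m \<le> d \<and>
     (\<forall>t\<in>{1..<m}. 2 + \<epsilon> (t + 1) * A $ p (t + 1) + \<epsilon> t * B $ p t \<le> d)"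
  unfolding chain_bound_def by (subst Max_le_iff) auto

lemma ex_facet_chain_of_indexed_chain:
  assumes "indexed_chain i m p \<epsilon>"
  shows "\<exists>xs. facet_chain i xs \<and> chain_within A B xs (chain_bound A B m p \<epsilon>)"
proof -
  let ?xs = "map (\<lambda>t. (p t, \<epsilon> t)) [1..<Suc m]"
  have m: "1 \<le> m" using assms by (simp add: indexed_chain_def)
  have p: "p t \<noteq> i" "\<epsilon> t \<in> {1, -1}" if "t \<in> {1..m}" for t
    using assms that unfolding indexed_chain_def by (blast, blast)
  have "set ?xs \<subseteq> side_facets i"
    using p by (force simp: side_facets_def)
  moreover have "distinct (map fst ?xs)"
    using assms by (simp add: indexed_chain_def distinct_map comp_def
        atLeastLessThanSuc_atLeastAtMost del: upt_Suc)
  moreover have "?xs \<noteq> []" using m by simp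
  ultimately have "facet_chain i ?xs" by (simp add: facet_chain_def del: upt_Suc)
  moreover have "chain_within A B ?xs (chain_bound A B m p \<epsilon>)"
  proof -
    have ends: "hd ?xs = (p 1, \<epsilon> 1)" "last ?xs = (p m, \<epsilon> m)"
      using m by (simp_all add: hd_map last_map hd_conv_nth del: upt_Suc)
    note le = iffD1[OF chain_bound_le_iff[of A B m p \<epsilon>] order_refl]
    have nth: "?xs ! k = (p (Suc k), \<epsilon> (Suc k))" if "k < m" for k
      using that by (simp del: upt_Suc)
    have "successively (\<lambda>y z. gap A z + gap B y \<le> chain_bound A B m p \<epsilon>) ?xs"
      unfolding successively_conv_nth
    proof (intro allI impI)
      fix k assume "Suc k < length ?xs"
      then have k: "Suc k < m" by (simp del: upt_Suc)
      then show "gap A (?xs ! Suc k) + gap B (?xs ! k) \<le> chain_bound A B m p \<epsilon>"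
        using nth[of k] nth[of "Suc k"] conjunct2[OF le, rule_format, of "Suc k"]
        by (simp add: gap_def del: upt_Suc)
    qed
    then show ?thesis
      using conjunct1[OF le] unfolding chain_within_def ends by (simp add: gap_def)
  qed
  ultimately show ?thesis by blast
qed

lemma ex_indexed_chain_of_facet_chain:
  fixes A B :: "real ^ 'n"
  assumes chain: "facet_chain i xs" and within: "chain_within A B xs d"
  shows "\<exists>m p \<epsilon>. indexed_chain i m p \<epsilon> \<and> chain_bound A B m p \<epsilon> \<le> d"
proof -
  let ?m = "length xs"
  define p where "p t = fst (xs ! (t - 1))" for t
  define \<epsilon> where "\<epsilon> t = snd (xs ! (t - 1))" for t
  have ne: "xs \<noteq> []" and sub: "set xs \<subseteq> side_facets i" and dist: "distinct (map fst xs)"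
    using chain by (auto simp: facet_chain_def)
  then have m: "1 \<le> ?m" by (simp add: Suc_le_eq)
  have inj: "inj_on p {1..?m}"
  proof (rule inj_onI)
    fix s t assume st: "s \<in> {1..?m}" "t \<in> {1..?m}" "p s = p t"
    then have "s - 1 < ?m" "t - 1 < ?m" by auto
    then have "s - 1 = t - 1"
      using st(3) nth_eq_iff_index_eq[OF dist, of "s - 1" "t - 1"] by (simp add: p_def)
    moreover have "1 \<le> s" "1 \<le> t" using st by auto
    ultimately show "s = t" by linarith
  qed
  have "xs ! (t - 1) \<in> side_facets i" if "t \<in> {1..?m}" for t
    using sub that by auto
  then have ran: "p ` {1..?m} \<subseteq> UNIV - {i}" "\<epsilon> ` {1..?m} \<subseteq> {1, -1}"
    by (fastforce simp: side_facets_def p_def \<epsilon>_def)+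
  have "card {1..?m} \<le> card (UNIV - {i})"
    by (rule card_inj_on_le[OF inj ran(1)]) simp
  then have "?m \<le> CARD('n) - 1" by (simp add: card_Diff_singleton)
  then have "indexed_chain i ?m p \<epsilon>"
    using inj ran m unfolding indexed_chain_def by blast
  moreover have "chain_bound A B ?m p \<epsilon> \<le> d"
    unfolding chain_bound_le_iff
  proof (intro conjI ballI)
    show "4 + \<epsilon> 1 * A $ p 1 + \<epsilon> ?m * B $ p ?m \<le> d"
      using within ne by (simp add: chain_within_def gap_def p_def \<epsilon>_def hd_conv_nth last_conv_nth)
    fix t assume t: "t \<in> {1..<?m}"
    then have "Suc (t - 1) < ?m" by auto
    with within have "gap A (xs ! Suc (t - 1)) + gap B (xs ! (t - 1)) \<le> d"
      by (auto simp: chain_within_def dest: successively_nth)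
    then show "2 + \<epsilon> (t + 1) * A $ p (t + 1) + \<epsilon> t * B $ p t \<le> d"
      using t by (simp add: gap_def p_def \<epsilon>_def)
  qed
  ultimately show ?thesis by blast
qed

lemma finite_chain_bounds:
  "finite {chain_bound A B m p \<epsilon> | m p \<epsilon>. indexed_chain i m p \<epsilon>}"
proof (rule finite_subset)
  let ?f = "\<lambda>(c, e, e', j, j'). c + e * A $ j + e' * B $ j' :: real"
  let ?V = "?f ` ({2, 4} \<times> {1, -1} \<times> {1, -1} \<times> UNIV \<times> UNIV)"
  show "finite ?V" by simp
  show "{chain_bound A B m p \<epsilon> | m p \<epsilon>. indexed_chain i m p \<epsilon>} \<subseteq> ?V"
  proof clarify
    fix m p \<epsilon> assume c: "indexed_chain i m p \<epsilon>"
    have V: "c + \<epsilon> s * A $ p s + \<epsilon> t * B $ p t \<in> ?V"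
      if "c \<in> {2, 4}" "s \<in> {1..m}" "t \<in> {1..m}" for c s t
    proof (rule image_eqI[of _ _ "(c, \<epsilon> s, \<epsilon> t, p s, p t)"])
      have "\<epsilon> s \<in> {1, -1}" "\<epsilon> t \<in> {1, -1}"
        using c that unfolding indexed_chain_def by blast+
      then show "(c, \<epsilon> s, \<epsilon> t, p s, p t) \<in> {2, 4} \<times> {1, -1} \<times> {1, -1} \<times> UNIV \<times> UNIV"
        using that by blast
    qed simp
    have "chain_bound A B m p \<epsilon> \<in> insert (4 + \<epsilon> 1 * A $ p 1 + \<epsilon> m * B $ p m)
       ((\<lambda>t. 2 + \<epsilon> (t + 1) * A $ p (t + 1) + \<epsilon> t * B $ p t) ` {1..<m})"
      unfolding chain_bound_def by (rule Max_in) auto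
    moreover have "1 \<le> m" using c by (simp add: indexed_chain_def)
    ultimately consider "chain_bound A B m p \<epsilon> = 4 + \<epsilon> 1 * A $ p 1 + \<epsilon> m * B $ p m" "1 \<le> m"
      | t where "t \<in> {1..<m}"
        "chain_bound A B m p \<epsilon> = 2 + \<epsilon> (t + 1) * A $ p (t + 1) + \<epsilon> t * B $ p t"
      by blast
    then show "chain_bound A B m p \<epsilon> \<in> ?V"
    proof cases
      case 1
      then show ?thesis using V[of 4 1 m] by simp
    next
      case (2 t)
      then show ?thesis using V[of 2 "t + 1" t] by simp
    qed
  qed
qed

theorem theorem4:
  fixes A B :: "real ^ 'n" and i1 :: 'n
  assumes "CARD('n) \<ge> 3"
    and "A \<in> sup_sphere" and "A $ i1 = 1"
    and "B \<in> sup_sphere" and "B $ i1 = -1"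
  shows "is_geodesic_distance A B
    (Min {Max (insert (4 + \<epsilon> 1 * A $ p 1 + \<epsilon> m * B $ p m)
                 ((\<lambda>t. 2 + \<epsilon> (t + 1) * A $ p (t + 1) + \<epsilon> t * B $ p t) ` {1..<m})) |
          (m :: nat) (p :: nat \<Rightarrow> 'n) (\<epsilon> :: nat \<Rightarrow> real).
          1 \<le> m \<and> m \<le> CARD('n) - 1 \<and>
          inj_on p {1..m} \<and> p ` {1..m} \<subseteq> UNIV - {i1} \<and>
          \<epsilon> ` {1..m} \<subseteq> {1, -1}})"
proof -
  define S where "S = {chain_bound A B m p \<epsilon> | m p \<epsilon>. indexed_chain i1 m p \<epsilon>}"
  define D where "D = Min S"
  have fin: "finite S" unfolding S_def by (rule finite_chain_bounds)
  have below: "D \<le> d" if c: "facet_chain i1 xs" "chain_within A B xs d" for xs d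
  proof -
    obtain m p \<epsilon> where "indexed_chain i1 m p \<epsilon>" "chain_bound A B m p \<epsilon> \<le> d"
      using ex_indexed_chain_of_facet_chain[OF c] by blast
    moreover from this have "chain_bound A B m p \<epsilon> \<in> S" unfolding S_def by blast
    ultimately show ?thesis using Min_le[OF fin] unfolding D_def by fastforce
  qed
  have lower: "ereal D \<le> arc_length g" if g: "g \<in> admissible_paths A B" for g
  proof (cases "arc_length g")
    case (real l)
    then show ?thesis
      using chain_within_arc_length[of g A B i1 l] g assms below
      by (auto simp: admissible_paths_def)
  qed (use arc_length_nonneg[of g] in auto)
  have "S \<noteq> {}"
  proof -
    have "\<exists>j. j \<noteq> i1"
    proof (rule ccontr)
      assume "\<nexists>j. j \<noteq> i1"
      then have "UNIV = {i1}" by blast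
      then have "CARD('n) = 1" by (metis card_1_singleton_iff One_nat_def)
      then show False using assms(1) by simp
    qed
    then obtain j where "j \<noteq> i1" ..
    then have "facet_chain i1 [(j, 1)]" by (simp add: facet_chain_def side_facets_def)
    moreover have "chain_within A B [(j, 1)] (2 + gap A (j, 1) + gap B (j, 1))"
      by (simp add: chain_within_def)
    ultimately obtain m p \<epsilon> where "indexed_chain i1 m p \<epsilon>"
      using ex_indexed_chain_of_facet_chain by blast
    then have "chain_bound A B m p \<epsilon> \<in> S" unfolding S_def by blast
    then show ?thesis by blast
  qed
  then have "D \<in> S" using fin unfolding D_def by (rule Min_in[rotated])
  then obtain xs0 where "facet_chain i1 xs0 \<and> chain_within A B xs0 D"
    unfolding S_def using ex_facet_chain_of_indexed_chain by fast
  then obtain xs where "facet_chain i1 xs \<and> chain_within A B xs D"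
    and "\<And>ys. facet_chain i1 ys \<and> chain_within A B ys D \<Longrightarrow> length xs \<le> length ys"
    using ex_has_least_nat[of "\<lambda>xs. facet_chain i1 xs \<and> chain_within A B xs D" _ length] by blast
  then interpret shortest_optimal_chain A B i1 xs D
    using assms below by unfold_locales auto
  obtain g where g: "g \<in> admissible_paths A B" "arc_length g \<le> ereal D"
    using ex_admissible_path by blast
  then have "arc_length g = ereal D" using lower by (simp add: order_antisym)
  then have "is_geodesic_distance A B D"
    using g lower by (auto simp: is_geodesic_distance_def)
  then show ?thesis
    by (simp only: D_def S_def chain_bound_def indexed_chain_def)
qed

end
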